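(* Let $R$ be a non-associative ring. Then $R$ is right quasi-associative if and only if $rR=\{rt : t\in R\}$ is a right ideal of $R$ for all $r\in R$. Likewise, $R$ is left quasi-associative if and only if $Rc=\{tc : t\in R\}$ is a left ideal of $R$ for all $c\in R$.
   Context: A non-associative ring is an additive abelian group with a multiplication that is left and right distributive over addition and not necessarily associative. A right (resp. left) ideal of a non-associative ring $R$ is an additive subgroup $I$ with $ir\in I$ (resp. $ri\in I$) for all $i\in I$, $r\in R$. $R$ is right (resp. left) quasi-associative if for all $r,b,c\in R$ there exists $s\in R$ such that $(rb)c=rs$ (resp. $r(bc)=sc$). *)

theory Defs
  imports "HOL-Algebra.AbelCoset"
begin

(* The record field for the unit is unconstrained: the rings need not be unital. *)
locale nonassoc_ring = abelian_group R for R (structure) +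
  assumes m_closed: "\<lbrakk>x \<in> carrier R; y \<in> carrier R\<rbrakk> \<Longrightarrow> x \<otimes> y \<in> carrier R"
    and l_distr: "\<lbrakk>x \<in> carrier R; y \<in> carrier R; z \<in> carrier R\<rbrakk>
      \<Longrightarrow> (x \<oplus> y) \<otimes> z = x \<otimes> z \<oplus> y \<otimes> z"
    and r_distr: "\<lbrakk>x \<in> carrier R; y \<in> carrier R; z \<in> carrier R\<rbrakk>
      \<Longrightarrow> z \<otimes> (x \<oplus> y) = z \<otimes> x \<oplus> z \<otimes> y"

definition right_ideal :: "'a set \<Rightarrow> ('a, 'm) ring_scheme \<Rightarrow> bool" where
  "right_ideal I R \<longleftrightarrow>
     additive_subgroup I R \<and> (\<forall>i\<in>I. \<forall>r\<in>carrier R. i \<otimes>\<^bsub>R\<^esub> r \<in> I)"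

definition left_ideal :: "'a set \<Rightarrow> ('a, 'm) ring_scheme \<Rightarrow> bool" where
  "left_ideal I R \<longleftrightarrow>
     additive_subgroup I R \<and> (\<forall>i\<in>I. \<forall>r\<in>carrier R. r \<otimes>\<^bsub>R\<^esub> i \<in> I)"

definition right_quasi_associative :: "('a, 'm) ring_scheme \<Rightarrow> bool" where
  "right_quasi_associative R \<longleftrightarrow>
     (\<forall>r\<in>carrier R. \<forall>b\<in>carrier R. \<forall>c\<in>carrier R. \<exists>s\<in>carrier R.
        (r \<otimes>\<^bsub>R\<^esub> b) \<otimes>\<^bsub>R\<^esub> c = r \<otimes>\<^bsub>R\<^esub> s)"

definition left_quasi_associative :: "('a, 'm) ring_scheme \<Rightarrow> bool" where
  "left_quasi_associative R \<longleftrightarrow>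
     (\<forall>r\<in>carrier R. \<forall>b\<in>carrier R. \<forall>c\<in>carrier R. \<exists>s\<in>carrier R.
        r \<otimes>\<^bsub>R\<^esub> (b \<otimes>\<^bsub>R\<^esub> c) = s \<otimes>\<^bsub>R\<^esub> c)"

end

theory Submission imports Defs begin

text \<open>By distributivity, multiplication by a fixed element, on either side, is an endomorphism
  of the additive group, so its image \<open>rR\<close> or \<open>Rc\<close> is always an additive
  subgroup (\<open>additive_subgroup_left_multiples\<close>,
  \<open>additive_subgroup_right_multiples\<close>). Being an ideal thus reduces to absorbing
  products, and this absorption, required for every \<open>r\<close> or every \<open>c\<close>, is
  quasi-associativity.\<close>

lemma (in abelian_group) additive_subgroup_image:
  assumes closed: "\<And>x. x \<in> carrier G \<Longrightarrow> f x \<in> carrier G"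
    and add: "\<And>x y. \<lbrakk>x \<in> carrier G; y \<in> carrier G\<rbrakk> \<Longrightarrow> f (x \<oplus> y) = f x \<oplus> f y"
  shows "additive_subgroup (f ` carrier G) G"
proof -
  \<comment> \<open>\<open>additive_subgroup\<close> is by definition a subgroup of
    \<open>add_monoid\<close>, so the fact that a homomorphic image is a subgroup applies
    there.\<close>
  have "group_hom (add_monoid G) (add_monoid G) f"
    using closed add by (intro group_hom.intro group_hom_axioms.intro a_group) (auto simp: hom_def)
  from group_hom.img_is_subgroup[OF this] show ?thesis
    by (simp add: additive_subgroup_def)
qed

context nonassoc_ring
begin

lemma additive_subgroup_left_multiples:
  assumes "r \<in> carrier R"
  shows "additive_subgroup {r \<otimes> t | t. t \<in> carrier R} R"
proof -
  have "additive_subgroup ((\<lambda>t. r \<otimes> t) ` carrier R) R"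
    using assms by (intro additive_subgroup_image) (auto simp: m_closed r_distr)
  then show ?thesis
    by (simp add: Setcompr_eq_image)
qed

lemma additive_subgroup_right_multiples:
  assumes "c \<in> carrier R"
  shows "additive_subgroup {t \<otimes> c | t. t \<in> carrier R} R"
proof -
  have "additive_subgroup ((\<lambda>t. t \<otimes> c) ` carrier R) R"
    using assms by (intro additive_subgroup_image) (auto simp: m_closed l_distr)
  then show ?thesis
    by (simp add: Setcompr_eq_image)
qed

text \<open>A typical element of \<open>rR\<close> is \<open>r \<otimes> b\<close>; that
  \<open>(r \<otimes> b) \<otimes> c\<close> lies in \<open>rR\<close> again is the existence of the
  required \<open>s\<close>.\<close>

lemma right_quasi_associative_iff:
  "right_quasi_associative R \<longleftrightarrow>
     (\<forall>r\<in>carrier R. right_ideal {r \<otimes> t | t. t \<in> carrier R} R)"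
  unfolding right_quasi_associative_def right_ideal_def
  using additive_subgroup_left_multiples by blast

text \<open>Mirror image: the fixed factor is now \<open>c\<close>, and \<open>s\<close> witnesses
  that \<open>r \<otimes> (b \<otimes> c)\<close> stays in \<open>Rc\<close>.\<close>

lemma left_quasi_associative_iff:
  "left_quasi_associative R \<longleftrightarrow>
     (\<forall>c\<in>carrier R. left_ideal {t \<otimes> c | t. t \<in> carrier R} R)"
  unfolding left_quasi_associative_def left_ideal_def
  using additive_subgroup_right_multiples by blast

end

theorem proposition3p4:
  fixes R :: "('a, 'm) ring_scheme" (structure)
  assumes "nonassoc_ring R"
  shows "(right_quasi_associative R \<longleftrightarrow>
            (\<forall>r\<in>carrier R. right_ideal {r \<otimes> t | t. t \<in> carrier R} R)) \<and>
         (left_quasi_associative R \<longleftrightarrow>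
            (\<forall>c\<in>carrier R. left_ideal {t \<otimes> c | t. t \<in> carrier R} R))"
  using nonassoc_ring.right_quasi_associative_iff[OF assms]
    nonassoc_ring.left_quasi_associative_iff[OF assms] by (rule conjI)

end
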